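(* Let $\mathscr{S}^3$ be the set of gap-frequency partitions in which each part appears at most $3$ times, and for $0\leq i,j\leq 3$ let $\mathscr{S}^3_{i,j}$ be the set of partitions in $\mathscr{S}^3$ in which at most $i$ of the parts are equal to $1$ and at most $j$ of the parts are equal to $2$ (so $\mathscr{S}^3_{3,3}=\mathscr{S}^3$). For nonnegative integers $\beta_1,\beta_2,\beta_3$ write $$H(\beta_1,\beta_2,\beta_3)=\sum_{n_1,n_2,n_3\geq 0}\frac{x^{n_1+2n_2+3n_3}y^{n_2}z^{n_3}\,q^{\binom{n_1}{2}+4\binom{n_2}{2}+9\binom{n_3}{2}+2n_1n_2+3n_1n_3+6n_2n_3+\beta_1n_1+\beta_2n_2+\beta_3n_3}}{(q;q)_{n_1}(q^2;q^2)_{n_2}(q^3;q^3)_{n_3}}.$$ Then, as formal power series in $x,y,z,q$, \begin{align*} \sum_{\lambda\in\mathscr{S}^3}x^{\ell(\lambda)}y^{\ell_2(\lambda)}z^{\ell_3(\lambda)}q^{|\lambda|}&=H(1,2,3),\\ \sum_{\lambda\in\mathscr{S}^3_{2,3}}x^{\ell(\lambda)}y^{\ell_2(\lambda)}z^{\ell_3(\lambda)}q^{|\lambda|}&=H(1,2,6),\\ \sum_{\lambda\in\mathscr{S}^3_{1,3}}x^{\ell(\lambda)}y^{\ell_2(\lambda)}z^{\ell_3(\lambda)}q^{|\lambda|}&=H(1,4,6),\\ \sum_{\lambda\in\mathscr{S}^3_{0,3}}x^{\ell(\lambda)}y^{\ell_2(\lambda)}z^{\ell_3(\lambda)}q^{|\lambda|}&=H(2,4,6),\\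 \sum_{\lambda\in\mathscr{S}^3_{0,2}}x^{\ell(\lambda)}y^{\ell_2(\lambda)}z^{\ell_3(\lambda)}q^{|\lambda|}&=H(2,4,9),\\ \sum_{\lambda\in\mathscr{S}^3_{0,0}}x^{\ell(\lambda)}y^{\ell_2(\lambda)}z^{\ell_3(\lambda)}q^{|\lambda|}&=H(3,6,9). \end{align*}
   Context: A partition $\lambda$ is a finite non-decreasing sequence of positive integers (its parts), the empty partition being allowed; $|\lambda|$ is the sum of its parts and $\ell(\lambda)$ is the number of its parts counted with multiplicity. For $m\geq 2$, $\ell_m(\lambda)$ is the number of parts repeated exactly $m$ times, i.e. the number of distinct integers $a$ that occur exactly $m$ times as a part of $\lambda$ (so e.g. $\ell_2(1+1)=1$). A partition is a gap-frequency partition if, whenever a part $a$ appears exactly $i$ times (with $i\ge 1$), the next strictly larger part (if any) is at least $a+i$, and if that next larger part is exactly $a+i$ then it appears at most $i$ times. For $n\ge 0$, $(A;q)_n=\prod_{j=0}^{n-1}(1-Aq^j)$; thus $(q^m;q^m)_n=\prod_{j=1}^{n}(1-q^{mj})$. *)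

theory Defs
  imports "HOL-Analysis.Infinite_Sum" "HOL-Computational_Algebra.Formal_Power_Series"
begin

section \<open>Gap-frequency partitions\<close>

definition partitions :: "nat list set" where
  "partitions = {l. sorted l \<and> (\<forall>a\<in>set l. 0 < a)}"

definition num_repeated :: "nat \<Rightarrow> nat list \<Rightarrow> nat" where
  "num_repeated m l = card {a \<in> set l. count_list l a = m}"

definition next_part :: "nat list \<Rightarrow> nat \<Rightarrow> nat \<Rightarrow> bool" where
  "next_part l a b \<longleftrightarrow> a \<in> set l \<and> b \<in> set l \<and> a < b \<and> \<not> (\<exists>c\<in>set l. a < c \<and> c < b)"

definition gap_frequency :: "nat list \<Rightarrow> bool" where
  "gap_frequency l \<longleftrightarrow>
     (\<forall>a b. next_part l a b \<longrightarrow>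
        a + count_list l a \<le> b \<and>
        (b = a + count_list l a \<longrightarrow> count_list l b \<le> count_list l a))"

definition S3 :: "nat list set" where
  "S3 = {l \<in> partitions. gap_frequency l \<and> (\<forall>a. count_list l a \<le> 3)}"

definition S3_sub :: "nat \<Rightarrow> nat \<Rightarrow> nat list set" where
  "S3_sub i j = {l \<in> S3. count_list l 1 \<le> i \<and> count_list l 2 \<le> j}"

section \<open>Formal power series in \<open>x, y, z, q\<close>\<close>

text \<open>
  The ring of formal power series in \<open>x\<close>, \<open>y\<close>, \<open>z\<close>, \<open>q\<close> is built by iterating the univariate
  construction.  The outermost variable is \<open>q\<close>, so the library topology used by infinite sums is
  the \<open>q\<close>-adic one: a family is summable as soon as each power of \<open>q\<close> receives only finitely many
  contributions.  Both sides of the identities converge in this sense.  The coefficients are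
  rational only because there is no inversion of power series over the integers in the library.
\<close>

type_synonym fps4 = "rat fps fps fps fps"

definition x_var :: fps4 where "x_var = fps_const (fps_const (fps_const fps_X))"
definition y_var :: fps4 where "y_var = fps_const (fps_const fps_X)"
definition z_var :: fps4 where "z_var = fps_const fps_X"
definition q_var :: fps4 where "q_var = fps_X"

definition qpoch :: "'a::comm_ring_1 \<Rightarrow> 'a \<Rightarrow> nat \<Rightarrow> 'a" where
  "qpoch A q n = (\<Prod>j<n. 1 - A * q ^ j)"

definition weight :: "nat list \<Rightarrow> fps4" where
  "weight l = x_var ^ length l * y_var ^ num_repeated 2 l * z_var ^ num_repeated 3 l
              * q_var ^ sum_list l"

definition H_term :: "nat \<Rightarrow> nat \<Rightarrow> nat \<Rightarrow> nat \<times> nat \<times> nat \<Rightarrow> fps4" where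
  "H_term \<beta>1 \<beta>2 \<beta>3 = (\<lambda>(n1, n2, n3).
     x_var ^ (n1 + 2 * n2 + 3 * n3) * y_var ^ n2 * z_var ^ n3
     * q_var ^ ((n1 choose 2) + 4 * (n2 choose 2) + 9 * (n3 choose 2)
                + 2 * n1 * n2 + 3 * n1 * n3 + 6 * n2 * n3
                + \<beta>1 * n1 + \<beta>2 * n2 + \<beta>3 * n3)
     / (qpoch q_var q_var n1 * qpoch (q_var ^ 2) (q_var ^ 2) n2 * qpoch (q_var ^ 3) (q_var ^ 3) n3))"

definition H :: "nat \<Rightarrow> nat \<Rightarrow> nat \<Rightarrow> fps4" where
  "H \<beta>1 \<beta>2 \<beta>3 = (\<Sum>\<^sub>\<infinity>n\<in>UNIV. H_term \<beta>1 \<beta>2 \<beta>3 n)"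

text \<open>
  The coefficient ring of the outermost series is not a field, so division is only meaningful when
  the denominator has an invertible constant coefficient.  The denominators above have constant
  coefficient \<open>1\<close>, and division by them is genuine.
\<close>

lemma fps_nth_0_qpoch:
  assumes "m > 0"
  shows "fps_nth (qpoch (q_var ^ m) (q_var ^ m) n) 0 = 1"
  using assms by (induction n) (simp_all add: qpoch_def q_var_def fps_mult_nth_0)

lemma fps_divide_mult_cancel:
  fixes f g :: fps4
  assumes "fps_nth g 0 = 1"
  shows "f / g * g = f"
proof -
  have "inverse (1 :: rat fps fps fps) = 1"
    by (intro fps_inverse_one') simp
  hence "g * inverse g = 1"
    unfolding fps_inverse_def[of g]
    by (intro fps_right_inverse) (simp add: assms)
  moreover have "f / g = f * inverse g"
    using assms by (intro fps_divide_unit) simp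
  ultimately show ?thesis
    by (simp add: mult.assoc mult.commute[of "inverse g"])
qed

lemma H_term_denominator:
  fixes f :: fps4 and n1 n2 n3 :: nat
  defines "d \<equiv> qpoch q_var q_var n1 * qpoch (q_var ^ 2) (q_var ^ 2) n2
                * qpoch (q_var ^ 3) (q_var ^ 3) n3"
  shows "f / d * d = f"
proof (rule fps_divide_mult_cancel)
  show "fps_nth d 0 = 1"
    using fps_nth_0_qpoch[of 1 n1] fps_nth_0_qpoch[of 2 n2] fps_nth_0_qpoch[of 3 n3]
    by (simp add: d_def fps_mult_nth_0)
qed

end

theory Submission
  imports Defs
begin

text \<open>
  Let \<open>F k i\<close> be the generating function of the partitions in \<open>S3\<close> with all parts larger than \<open>k\<close>
  and at most \<open>i\<close> parts equal to \<open>k + 1\<close>.  Removing a block of exactly \<open>i\<close> copies of \<open>k + 1\<close>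
  leaves a partition counted by \<open>F (k + i) i\<close>, because the gap condition bounds the next part below
  by \<open>k + 1 + i\<close> and allows at most \<open>i\<close> copies of it.  On the side of the multisums, the same
  recurrence comes from \<open>1 - q\<^sup>i\<^sup>n\<close> cancelling the last factor of the \<open>q\<close>-factorial of \<open>n = n\<^sub>i\<close>,
  followed by the shift of \<open>n\<^sub>i\<close> by one.  The recurrence has only one solution with
  \<open>F k 3 = 1 + O(q\<^sup>k\<^sup>+\<^sup>1)\<close>, since in each degree the difference of two
  solutions at \<open>(k, i)\<close> equals that at \<open>(k + 1, 3)\<close> once it vanishes in all lower degrees.
\<close>

section \<open>Infinite sums of formal power series\<close>

text \<open>Convergence means that each coefficient is eventually constant. Coefficient
  \<open>n\<close> of a sum settles once those of both summands do. Infinite sums may then be added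
  and joined over disjoint sets.\<close>

instance fps :: (ab_group_add) topological_comm_monoid_add
proof
  fix a b :: "'a fps"
  show "((\<lambda>x. fst x + snd x) \<longlongrightarrow> a + b) (nhds a \<times>\<^sub>F nhds b)"
  proof (rule tendsto_fpsI)
    fix n
    have "\<forall>\<^sub>F x in nhds a \<times>\<^sub>F nhds b. fps_nth (fst x) n = fps_nth a n \<and> fps_nth (snd x) n = fps_nth b n"
      using filterlim_fst[of "nhds a" "nhds b"] filterlim_snd[of "nhds b" "nhds a"]
      by (auto simp: tendsto_fps_iff intro: eventually_conj)
    thus "\<forall>\<^sub>F x in nhds a \<times>\<^sub>F nhds b. fps_nth (fst x + snd x) n = fps_nth (a + b) n"
      by eventually_elim simp
  qed
qed

text \<open>Coefficient \<open>n\<close> of a product involves only the finitely many coefficients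
  up to \<open>n\<close> of the factors. Constant factors may then be moved through infinite
  sums.\<close>

instance fps :: (comm_ring) topological_semigroup_mult
proof
  fix a b :: "'a fps"
  show "((\<lambda>x. fst x * snd x) \<longlongrightarrow> a * b) (nhds a \<times>\<^sub>F nhds b)"
  proof (rule tendsto_fpsI)
    fix n
    have "\<forall>\<^sub>F x in nhds a \<times>\<^sub>F nhds b. \<forall>k\<in>{..n}. fps_nth (fst x) k = fps_nth a k \<and> fps_nth (snd x) k = fps_nth b k"
      using filterlim_fst[of "nhds a" "nhds b"] filterlim_snd[of "nhds b" "nhds a"]
      by (intro eventually_ball_finite) (auto simp: tendsto_fps_iff intro: eventually_conj)
    thus "\<forall>\<^sub>F x in nhds a \<times>\<^sub>F nhds b. fps_nth (fst x * snd x) n = fps_nth (a * b) n"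
      by eventually_elim (auto simp: fps_mult_nth intro!: sum.cong)
  qed
qed

lemma summable_on_fpsI:
  fixes F :: "'a \<Rightarrow> 'b::ab_group_add fps"
  assumes "\<And>n. finite {x\<in>A. fps_nth (F x) n \<noteq> 0}"
  shows "F summable_on A"
proof -
  have "(F has_sum Abs_fps (\<lambda>n. \<Sum>x | x \<in> A \<and> fps_nth (F x) n \<noteq> 0. fps_nth (F x) n)) A"
    by (rule has_sum_fpsI) (simp_all add: assms)
  thus ?thesis by (rule has_sum_imp_summable)
qed

lemma has_sum_fps_nth_single:
  fixes F :: "'a \<Rightarrow> 'b::ab_group_add fps"
  assumes "(F has_sum S) A" "a \<in> A" "\<And>x. x \<in> A \<Longrightarrow> x \<noteq> a \<Longrightarrow> fps_nth (F x) n = 0"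
  shows "fps_nth S n = fps_nth (F a) n"
proof -
  have "fps_nth S n = (\<Sum>x | x \<in> A \<and> fps_nth (F x) n \<noteq> 0. fps_nth (F x) n)"
    by (rule has_sum_fpsD) fact
  also have "\<dots> = (\<Sum>x\<in>{a}. fps_nth (F x) n)"
    using assms(2,3) by (intro sum.mono_neutral_left) auto
  finally show ?thesis by simp
qed

section \<open>The system of recurrences\<close>

text \<open>In both models below \<open>N\<close> is 3, and \<open>c i\<close> is the weight of a
  block of \<open>i\<close> equal parts without its power of q. That power, in \<open>step\<close>,
  is the size of \<open>Suc i\<close> copies of \<open>Suc k\<close>.\<close>

locale gap_recurrence =
  fixes N :: nat and c :: "nat \<Rightarrow> 'a::comm_ring_1 fps" and F :: "nat \<Rightarrow> nat \<Rightarrow> 'a fps"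
  assumes wrap: "F k 0 = F (Suc k) N"
    and step: "i < N \<Longrightarrow>
      F k (Suc i) = F k i + c (Suc i) * fps_X ^ (Suc i * Suc k) * F (k + Suc i) (Suc i)"
    and initial: "n \<le> k \<Longrightarrow> fps_nth (F k N) n = (if n = 0 then 1 else 0)"

lemma gap_recurrence_unique:
  assumes F: "gap_recurrence N c F" and G: "gap_recurrence N c G" and "i \<le> N"
  shows "F k i = G k i"
proof -
  interpret F: gap_recurrence N c F by fact
  interpret G: gap_recurrence N c G by fact
  define D where "D k i = F k i - G k i" for k i
  have D0: "D k 0 = D (Suc k) N" for k
    by (simp add: D_def F.wrap G.wrap)
  have D1: "D k (Suc i) = D k i + fps_X ^ (Suc i * Suc k) * (c (Suc i) * D (k + Suc i) (Suc i))"
    if "i < N" for k i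
    unfolding D_def F.step[OF that, of k] G.step[OF that, of k] by (simp only: algebra_simps)
  have "\<forall>k. \<forall>i\<le>N. fps_nth (D k i) n = 0" for n
  proof (induction n rule: less_induct)
    case (less n)
    have IH: "fps_nth (c (Suc i) * D (k + Suc i) (Suc i)) m = 0" if "m < n" "i < N" for k i m
      unfolding fps_mult_nth using that less by (intro sum.neutral ballI) auto
    \<comment> \<open>The block term carries a positive power of \<open>fps_X\<close>, so in degree
      \<open>n\<close> it only sees lower degrees of its cofactor and vanishes by \<open>IH\<close>.
      Lowering \<open>i\<close> to 0 and wrapping then leads to \<open>(Suc k, N)\<close>.\<close>
    have eq: "fps_nth (D k i) n = fps_nth (D (Suc k) N) n" if "i \<le> N" for k i
      using that
    proof (induction i)
      case 0
      show ?case by (simp add: D0)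
    next
      case (Suc i)
      have "n - Suc i * Suc k < n" if "\<not> n < Suc i * Suc k"
        using that by simp
      hence "fps_nth (fps_X ^ (Suc i * Suc k) * (c (Suc i) * D (k + Suc i) (Suc i))) n = 0"
        unfolding fps_X_power_mult_nth using IH Suc.prems by (meson Suc_le_lessD)
      with Suc show ?case by (simp only: D1[of i k] fps_add_nth Suc_le_eq) simp
    qed
    have shift: "fps_nth (D (Suc k) N) n = fps_nth (D (Suc k + j) N) n" for k j
      
    proof (induction j)
      case (Suc j)
      with eq[OF order_refl, of "Suc k + j"] show ?case by simp
    qed simp
    \<comment> \<open>The first index can be raised past \<open>n\<close>, where
      \<open>initial\<close> prescribes the coefficient of both solutions.\<close>
    have "fps_nth (D k i) n = 0" if "i \<le> N" for k i
      using eq[OF that, of k] shift[of k n]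
        F.initial[of n "Suc k + n"] G.initial[of n "Suc k + n"]
      by (simp add: D_def)
    thus ?case by blast
  qed
  hence "D k i = 0"
    using \<open>i \<le> N\<close> by (intro fps_ext) simp
  thus ?thesis by (simp add: D_def)
qed

section \<open>The multisums\<close>

definition H_exponent :: "nat \<Rightarrow> nat \<Rightarrow> nat \<Rightarrow> nat \<Rightarrow> nat \<Rightarrow> nat \<Rightarrow> nat" where
  "H_exponent b1 b2 b3 n1 n2 n3 = (n1 choose 2) + 4 * (n2 choose 2) + 9 * (n3 choose 2)
     + 2 * n1 * n2 + 3 * n1 * n3 + 6 * n2 * n3 + b1 * n1 + b2 * n2 + b3 * n3"

definition H_denominator :: "nat \<Rightarrow> nat \<Rightarrow> nat \<Rightarrow> fps4" where
  "H_denominator n1 n2 n3 =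
     qpoch q_var q_var n1 * qpoch (q_var ^ 2) (q_var ^ 2) n2 * qpoch (q_var ^ 3) (q_var ^ 3) n3"

lemma H_denominator_nth_0: "fps_nth (H_denominator n1 n2 n3) 0 = 1"
  using fps_nth_0_qpoch[of 1 n1] fps_nth_0_qpoch[of 2 n2] fps_nth_0_qpoch[of 3 n3]
  by (simp add: H_denominator_def fps_mult_nth_0)

lemma H_denominator_nonzero: "H_denominator n1 n2 n3 \<noteq> 0"
  using H_denominator_nth_0[of n1 n2 n3] by (metis fps_zero_nth zero_neq_one)

lemma H_denominator_Suc:
  "H_denominator (Suc n1) n2 n3 = H_denominator n1 n2 n3 * (1 - q_var ^ Suc n1)"
  "H_denominator n1 (Suc n2) n3 = H_denominator n1 n2 n3 * (1 - q_var ^ (2 * Suc n2))"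
  "H_denominator n1 n2 (Suc n3) = H_denominator n1 n2 n3 * (1 - q_var ^ (3 * Suc n3))"
  unfolding H_denominator_def qpoch_def prod.lessThan_Suc power_mult power_Suc
  by (simp_all only: mult_ac)

lemma H_term_mult_denominator:
  "H_term b1 b2 b3 (n1, n2, n3) * H_denominator n1 n2 n3 =
     x_var ^ (n1 + 2 * n2 + 3 * n3) * y_var ^ n2 * z_var ^ n3 * q_var ^ H_exponent b1 b2 b3 n1 n2 n3"
  unfolding H_term_def H_denominator_def H_exponent_def by (simp add: H_term_denominator)

text \<open>The contribution of \<open>b1\<close>, \<open>b2\<close>, \<open>b3\<close> to the
  exponent splits off as a power of q; the exponent with all three parameters set to 0 goes into the
  cofactor. This bounds from below the degrees at which a term contributes.\<close>

lemma H_term_eq_power_mult: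
  "\<exists>g. H_term b1 b2 b3 (n1, n2, n3) = fps_X ^ (b1 * n1 + b2 * n2 + b3 * n3) * g"
proof -
  define c where "c = x_var ^ (n1 + 2 * n2 + 3 * n3) * y_var ^ n2 * z_var ^ n3
    * fps_X ^ H_exponent 0 0 0 n1 n2 n3"
  define g where "g = c / H_denominator n1 n2 n3"
  have g: "g * H_denominator n1 n2 n3 = c"
    unfolding g_def by (rule fps_divide_mult_cancel) (rule H_denominator_nth_0)
  have e: "H_exponent b1 b2 b3 n1 n2 n3 =
      b1 * n1 + b2 * n2 + b3 * n3 + H_exponent 0 0 0 n1 n2 n3"
    by (simp add: H_exponent_def)
  have "H_term b1 b2 b3 (n1, n2, n3) * H_denominator n1 n2 n3 =
      fps_X ^ (b1 * n1 + b2 * n2 + b3 * n3) * g * H_denominator n1 n2 n3"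
    unfolding H_term_mult_denominator e mult.assoc[of _ g] g c_def
    by (simp only: q_var_def power_add mult_ac)
  thus ?thesis
    using H_denominator_nonzero by (metis mult_right_cancel)
qed

lemma H_term_nth_eq_0:
  assumes "m < b1 * n1 + b2 * n2 + b3 * n3"
  shows "fps_nth (H_term b1 b2 b3 (n1, n2, n3)) m = 0"
proof -
  obtain g where "H_term b1 b2 b3 (n1, n2, n3) = fps_X ^ (b1 * n1 + b2 * n2 + b3 * n3) * g"
    using H_term_eq_power_mult by blast
  thus ?thesis
    using assms by (simp add: fps_X_power_mult_nth)
qed

lemma H_term_zero: "H_term b1 b2 b3 (0, 0, 0) = 1"
  using H_term_mult_denominator[of b1 b2 b3 0 0 0]
  by (simp add: H_exponent_def H_denominator_def qpoch_def binomial_eq_0)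

text \<open>With positive parameters, \<open>b1 * n1 + b2 * n2 + b3 * n3\<close> bounds each index,
  so only finitely many terms reach degree \<open>m\<close>.\<close>

lemma has_sum_H:
  assumes "b1 > 0" "b2 > 0" "b3 > 0"
  shows "(H_term b1 b2 b3 has_sum H b1 b2 b3) UNIV"
proof -
  have "finite {n \<in> UNIV. fps_nth (H_term b1 b2 b3 n) m \<noteq> 0}" for m
  proof (rule finite_subset)
    show "{n \<in> UNIV. fps_nth (H_term b1 b2 b3 n) m \<noteq> 0} \<subseteq> {..m} \<times> {..m} \<times> {..m}"
    proof
      fix n assume "n \<in> {n \<in> UNIV. fps_nth (H_term b1 b2 b3 n) m \<noteq> 0}"
      moreover obtain n1 n2 n3 where n: "n = (n1, n2, n3)" by (cases n)
      ultimately have "fps_nth (H_term b1 b2 b3 (n1, n2, n3)) m \<noteq> 0" by simp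
      hence "b1 * n1 + b2 * n2 + b3 * n3 \<le> m"
        using H_term_nth_eq_0 not_le by blast
      moreover have "n1 \<le> b1 * n1" "n2 \<le> b2 * n2" "n3 \<le> b3 * n3"
        using assms by simp_all
      ultimately have "n1 \<le> m" "n2 \<le> m" "n3 \<le> m" by linarith+
      thus "n \<in> {..m} \<times> {..m} \<times> {..m}" by (simp add: n)
    qed
  qed simp
  hence "H_term b1 b2 b3 summable_on UNIV"
    by (rule summable_on_fpsI)
  thus ?thesis unfolding H_def by simp
qed

text \<open>Every index other than \<open>(0, 0, 0)\<close> starts at a degree no smaller than one
  of the parameters, hence above \<open>m\<close>. This yields \<open>initial\<close> for the
  multisums.\<close>

lemma H_nth_small:
  assumes "m < b1" "m < b2" "m < b3"
  shows "fps_nth (H b1 b2 b3) m = (if m = 0 then 1 else 0)"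
proof -
  have "fps_nth (H_term b1 b2 b3 n) m = 0" if "n \<noteq> (0, 0, 0)" for n
  proof (cases n)
    case (fields n1 n2 n3)
    have "n1 > 0 \<or> n2 > 0 \<or> n3 > 0"
      using that fields by simp
    moreover have "m < b * n'" if "n' > 0" "m < b" for b n' :: nat
      using that by (metis less_le_trans mult_le_mono2 mult.right_neutral Suc_leI One_nat_def)
    ultimately have "m < b1 * n1 + b2 * n2 + b3 * n3"
      using assms by (metis trans_less_add1 trans_less_add2)
    thus ?thesis
      unfolding fields by (rule H_term_nth_eq_0)
  qed
  hence "fps_nth (H b1 b2 b3) m = fps_nth (H_term b1 b2 b3 (0, 0, 0)) m"
    using assms by (intro has_sum_fps_nth_single[OF has_sum_H]) auto
  thus ?thesis by (simp add: H_term_zero)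
qed

section \<open>Difference equations of the multisums\<close>

lemma H_exponent_Suc:
  "H_exponent b1 b2 b3 (Suc n1) n2 n3 = b1 + H_exponent (b1 + 1) (b2 + 2) (b3 + 3) n1 n2 n3"
  "H_exponent b1 b2 b3 n1 (Suc n2) n3 = b2 + H_exponent (b1 + 2) (b2 + 4) (b3 + 6) n1 n2 n3"
  "H_exponent b1 b2 b3 n1 n2 (Suc n3) = b3 + H_exponent (b1 + 3) (b2 + 6) (b3 + 9) n1 n2 n3"
proof -
  \<comment> \<open>Up to linear terms the exponent is half the square of
    \<open>s = n1 + 2 * n2 + 3 * n3\<close>. Raising \<open>n1\<close>, \<open>n2\<close> or
    \<open>n3\<close> by one therefore adds \<open>s\<close>, \<open>2 * s\<close> or
    \<open>3 * s\<close> besides a parameter, and these multiples of \<open>s\<close> are absorbed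
    by the parameters.\<close>
  have "Suc n choose 2 = n + (n choose 2)" for n
    by (simp add: numeral_2_eq_2)
  thus
    "H_exponent b1 b2 b3 (Suc n1) n2 n3 = b1 + H_exponent (b1 + 1) (b2 + 2) (b3 + 3) n1 n2 n3"
    "H_exponent b1 b2 b3 n1 (Suc n2) n3 = b2 + H_exponent (b1 + 2) (b2 + 4) (b3 + 6) n1 n2 n3"
    "H_exponent b1 b2 b3 n1 n2 (Suc n3) = b3 + H_exponent (b1 + 3) (b2 + 6) (b3 + 9) n1 n2 n3"
    by (simp_all add: H_exponent_def algebra_simps)
qed

lemma H_exponent_shift:
  "H_exponent (b1 + 1) b2 b3 n1 n2 n3 = n1 + H_exponent b1 b2 b3 n1 n2 n3"
  "H_exponent b1 (b2 + 2) b3 n1 n2 n3 = 2 * n2 + H_exponent b1 b2 b3 n1 n2 n3"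
  "H_exponent b1 b2 (b3 + 3) n1 n2 n3 = 3 * n3 + H_exponent b1 b2 b3 n1 n2 n3"
  by (simp_all add: H_exponent_def algebra_simps)

lemma H_term_diff_0:
  "H_term b1 b2 b3 (0, n2, n3) = H_term (b1 + 1) b2 b3 (0, n2, n3)"
  "H_term b1 b2 b3 (n1, 0, n3) = H_term b1 (b2 + 2) b3 (n1, 0, n3)"
  "H_term b1 b2 b3 (n1, n2, 0) = H_term b1 b2 (b3 + 3) (n1, n2, 0)"
  by (simp_all add: H_term_def binomial_eq_0 add_ac)

text \<open>Raising \<open>b1\<close> by one multiplies a term by a power of q equal to its first
  index, so the difference carries \<open>1 - q_var ^ Suc n1\<close>. This cancels the last factor
  of the first q-factorial.\<close>

lemma H_term_diff_Suc1:
  "H_term b1 b2 b3 (Suc n1, n2, n3) - H_term (b1 + 1) b2 b3 (Suc n1, n2, n3)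
     = x_var * q_var ^ b1 * H_term (b1 + 1) (b2 + 2) (b3 + 3) (n1, n2, n3)" (is "?L = ?R")
proof -
  define E where "E = H_exponent (b1 + 1) (b2 + 2) (b3 + 3) n1 n2 n3"
  \<comment> \<open>Multiplied by the denominator, the identity involves only powers of the
    variables; the nonzero denominator is cancelled at the end.\<close>
  have "?L * H_denominator (Suc n1) n2 n3 =
      x_var ^ (Suc n1 + 2 * n2 + 3 * n3) * y_var ^ n2 * z_var ^ n3 * q_var ^ (b1 + E)
        * (1 - q_var ^ Suc n1)"
    unfolding left_diff_distrib H_term_mult_denominator H_exponent_shift(1)
    unfolding H_exponent_Suc(1) E_def[symmetric]
    by (simp only: power_add algebra_simps mult_1_left mult_1_right)
  also have "\<dots> = x_var * q_var ^ b1
      * (H_term (b1 + 1) (b2 + 2) (b3 + 3) (n1, n2, n3) * H_denominator n1 n2 n3) * (1 - q_var ^ Suc n1)"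
    unfolding H_term_mult_denominator E_def[symmetric] mult_Suc_right power_add power_Suc
    by (simp only: mult_ac)
  also have "\<dots> = ?R * H_denominator (Suc n1) n2 n3"
    by (simp only: H_denominator_Suc mult_ac)
  finally show ?thesis
    using H_denominator_nonzero by (metis mult_right_cancel)
qed

text \<open>The second q-factorial has base \<open>q_var ^ 2\<close>, so \<open>b2\<close> has to
  move by 2 for the factor to cancel; likewise \<open>b3\<close> moves by 3 below.\<close>

lemma H_term_diff_Suc2:
  "H_term b1 b2 b3 (n1, Suc n2, n3) - H_term b1 (b2 + 2) b3 (n1, Suc n2, n3)
     = x_var ^ 2 * y_var * q_var ^ b2 * H_term (b1 + 2) (b2 + 4) (b3 + 6) (n1, n2, n3)"
  (is "?L = ?R")
proof -
  define E where "E = H_exponent (b1 + 2) (b2 + 4) (b3 + 6) n1 n2 n3"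
  have "?L * H_denominator n1 (Suc n2) n3 =
      x_var ^ (n1 + 2 * Suc n2 + 3 * n3) * y_var ^ Suc n2 * z_var ^ n3 * q_var ^ (b2 + E)
        * (1 - q_var ^ (2 * Suc n2))"
    unfolding left_diff_distrib H_term_mult_denominator H_exponent_shift(2)
    unfolding H_exponent_Suc(2) E_def[symmetric]
    by (simp only: power_add algebra_simps mult_1_left mult_1_right)
  also have "\<dots> = x_var ^ 2 * y_var * q_var ^ b2
      * (H_term (b1 + 2) (b2 + 4) (b3 + 6) (n1, n2, n3) * H_denominator n1 n2 n3) * (1 - q_var ^ (2 * Suc n2))"
    unfolding H_term_mult_denominator E_def[symmetric] mult_Suc_right power_add power_Suc
    by (simp only: mult_ac)
  also have "\<dots> = ?R * H_denominator n1 (Suc n2) n3"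
    by (simp only: H_denominator_Suc mult_ac)
  finally show ?thesis
    using H_denominator_nonzero by (metis mult_right_cancel)
qed

lemma H_term_diff_Suc3:
  "H_term b1 b2 b3 (n1, n2, Suc n3) - H_term b1 b2 (b3 + 3) (n1, n2, Suc n3)
     = x_var ^ 3 * z_var * q_var ^ b3 * H_term (b1 + 3) (b2 + 6) (b3 + 9) (n1, n2, n3)"
  (is "?L = ?R")
proof -
  define E where "E = H_exponent (b1 + 3) (b2 + 6) (b3 + 9) n1 n2 n3"
  have "?L * H_denominator n1 n2 (Suc n3) =
      x_var ^ (n1 + 2 * n2 + 3 * Suc n3) * y_var ^ n2 * z_var ^ Suc n3 * q_var ^ (b3 + E)
        * (1 - q_var ^ (3 * Suc n3))"
    unfolding left_diff_distrib H_term_mult_denominator H_exponent_shift(3)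
    unfolding H_exponent_Suc(3) E_def[symmetric]
    by (simp only: power_add algebra_simps mult_1_left mult_1_right)
  also have "\<dots> = x_var ^ 3 * z_var * q_var ^ b3
      * (H_term (b1 + 3) (b2 + 6) (b3 + 9) (n1, n2, n3) * H_denominator n1 n2 n3) * (1 - q_var ^ (3 * Suc n3))"
    unfolding H_term_mult_denominator E_def[symmetric] mult_Suc_right power_add power_Suc
    by (simp only: mult_ac)
  also have "\<dots> = ?R * H_denominator n1 n2 (Suc n3)"
    by (simp only: H_denominator_Suc mult_ac)
  finally show ?thesis
    using H_denominator_nonzero by (metis mult_right_cancel)
qed

text \<open>The difference of two series is summed termwise: it vanishes off the range of
  \<open>s\<close>, and along \<open>s\<close> it is \<open>c\<close> times the third
  series.\<close>

lemma H_eq_add_by_shift: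
  assumes pos: "b1 > 0" "b2 > 0" "b3 > 0" "b1' > 0" "b2' > 0" "b3' > 0"
      "b1'' > 0" "b2'' > 0" "b3'' > 0"
    and s: "inj s"
    and shift: "\<And>n. H_term b1 b2 b3 (s n) - H_term b1' b2' b3' (s n) = c * H_term b1'' b2'' b3'' n"
    and neutral: "\<And>n. n \<notin> range s \<Longrightarrow> H_term b1 b2 b3 n = H_term b1' b2' b3' n"
  shows "H b1 b2 b3 = H b1' b2' b3' + c * H b1'' b2'' b3''"
proof -
  define D where "D n = H_term b1 b2 b3 n - H_term b1' b2' b3' n" for n
  have "D \<circ> s = (\<lambda>n. c * H_term b1'' b2'' b3'' n)"
    by (simp add: D_def shift fun_eq_iff)
  hence "(D has_sum c * H b1'' b2'' b3'') (range s)"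
    using has_sum_cmult_right[OF has_sum_H[of b1'' b2'' b3''], of c] pos
    by (simp add: has_sum_reindex[OF s])
  hence "(D has_sum c * H b1'' b2'' b3'') UNIV"
    by (subst has_sum_cong_neutral[of "range s" UNIV D D])
       (auto simp: D_def neutral)
  from has_sum_add[OF has_sum_H[of b1' b2' b3'] this] pos
  have "(H_term b1 b2 b3 has_sum (H b1' b2' b3' + c * H b1'' b2'' b3'')) UNIV"
    by (simp add: D_def)
  thus ?thesis
    using has_sum_unique has_sum_H pos by blast
qed

text \<open>The shift raises \<open>n1\<close>, so its range misses only the indices with
  \<open>n1 = 0\<close>, where \<open>b1\<close> does not affect the exponent.\<close>

lemma H_rec1:
  assumes "b1 > 0" "b2 > 0" "b3 > 0"
  shows "H b1 b2 b3 = H (b1 + 1) b2 b3 + x_var * q_var ^ b1 * H (b1 + 1) (b2 + 2) (b3 + 3)"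
proof (rule H_eq_add_by_shift[where s = "\<lambda>(n1, n2, n3). (Suc n1, n2, n3)"])
  fix n :: "nat \<times> nat \<times> nat" assume n: "n \<notin> range (\<lambda>(n1, n2, n3). (Suc n1, n2, n3))"
  obtain n1 n2 n3 where eq: "n = (n1, n2, n3)" by (cases n)
  have "n1 = 0"
  proof (rule ccontr)
    assume "n1 \<noteq> 0"
    hence "n = (\<lambda>(n1, n2, n3). (Suc n1, n2, n3)) (n1 - 1, n2, n3)" by (simp add: eq)
    with n show False by blast
  qed
  thus "H_term b1 b2 b3 n = H_term (b1 + 1) b2 b3 n"
    using H_term_diff_0(1)[of b1 b2 b3 n2 n3] by (simp add: eq)
next
  fix n
  show "H_term b1 b2 b3 (case n of (n1, n2, n3) \<Rightarrow> (Suc n1, n2, n3))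
      - H_term (b1 + 1) b2 b3 (case n of (n1, n2, n3) \<Rightarrow> (Suc n1, n2, n3))
      = x_var * q_var ^ b1 * H_term (b1 + 1) (b2 + 2) (b3 + 3) n"
    by (cases n) (simp only: H_term_diff_Suc1 prod.case)
next
  show "inj (\<lambda>(n1, n2, n3). (Suc n1, n2, n3) :: nat \<times> nat \<times> nat)"
    by (rule injI) (clarsimp split: prod.splits)
qed (simp_all add: assms)

lemma H_rec2:
  assumes "b1 > 0" "b2 > 0" "b3 > 0"
  shows "H b1 b2 b3 = H b1 (b2 + 2) b3 + x_var ^ 2 * y_var * q_var ^ b2 * H (b1 + 2) (b2 + 4) (b3 + 6)"
proof (rule H_eq_add_by_shift[where s = "\<lambda>(n1, n2, n3). (n1, Suc n2, n3)"])
  fix n :: "nat \<times> nat \<times> nat" assume n: "n \<notin> range (\<lambda>(n1, n2, n3). (n1, Suc n2, n3))"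
  obtain n1 n2 n3 where eq: "n = (n1, n2, n3)" by (cases n)
  have "n2 = 0"
  proof (rule ccontr)
    assume "n2 \<noteq> 0"
    hence "n = (\<lambda>(n1, n2, n3). (n1, Suc n2, n3)) (n1, n2 - 1, n3)" by (simp add: eq)
    with n show False by blast
  qed
  thus "H_term b1 b2 b3 n = H_term b1 (b2 + 2) b3 n"
    using H_term_diff_0(2)[of b1 b2 b3 n1 n3] by (simp add: eq)
next
  fix n
  show "H_term b1 b2 b3 (case n of (n1, n2, n3) \<Rightarrow> (n1, Suc n2, n3))
      - H_term b1 (b2 + 2) b3 (case n of (n1, n2, n3) \<Rightarrow> (n1, Suc n2, n3))
      = x_var ^ 2 * y_var * q_var ^ b2 * H_term (b1 + 2) (b2 + 4) (b3 + 6) n"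
    by (cases n) (simp only: H_term_diff_Suc2 prod.case)
next
  show "inj (\<lambda>(n1, n2, n3). (n1, Suc n2, n3) :: nat \<times> nat \<times> nat)"
    by (rule injI) (clarsimp split: prod.splits)
qed (simp_all add: assms)

lemma H_rec3:
  assumes "b1 > 0" "b2 > 0" "b3 > 0"
  shows "H b1 b2 b3 = H b1 b2 (b3 + 3) + x_var ^ 3 * z_var * q_var ^ b3 * H (b1 + 3) (b2 + 6) (b3 + 9)"
proof (rule H_eq_add_by_shift[where s = "\<lambda>(n1, n2, n3). (n1, n2, Suc n3)"])
  fix n :: "nat \<times> nat \<times> nat" assume n: "n \<notin> range (\<lambda>(n1, n2, n3). (n1, n2, Suc n3))"
  obtain n1 n2 n3 where eq: "n = (n1, n2, n3)" by (cases n)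
  have "n3 = 0"
  proof (rule ccontr)
    assume "n3 \<noteq> 0"
    hence "n = (\<lambda>(n1, n2, n3). (n1, n2, Suc n3)) (n1, n2, n3 - 1)" by (simp add: eq)
    with n show False by blast
  qed
  thus "H_term b1 b2 b3 n = H_term b1 b2 (b3 + 3) n"
    using H_term_diff_0(3)[of b1 b2 b3 n1 n2] by (simp add: eq)
next
  fix n
  show "H_term b1 b2 b3 (case n of (n1, n2, n3) \<Rightarrow> (n1, n2, Suc n3))
      - H_term b1 b2 (b3 + 3) (case n of (n1, n2, n3) \<Rightarrow> (n1, n2, Suc n3))
      = x_var ^ 3 * z_var * q_var ^ b3 * H_term (b1 + 3) (b2 + 6) (b3 + 9) n"
    by (cases n) (simp only: H_term_diff_Suc3 prod.case)
next
  show "inj (\<lambda>(n1, n2, n3). (n1, n2, Suc n3) :: nat \<times> nat \<times> nat)"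
    by (rule injI) (clarsimp split: prod.splits)
qed (simp_all add: assms)

section \<open>The multisums as a solution of the recurrence\<close>

definition block_coeff :: "nat \<Rightarrow> fps4" where
  "block_coeff i = x_var ^ i * (if i = 2 then y_var else 1) * (if i = 3 then z_var else 1)"

text \<open>Parameter number \<open>j\<close> is \<open>j * (k + 1)\<close>, the size of
  \<open>j\<close> copies of \<open>k + 1\<close>, when \<open>j \<le> i\<close> allows that block,
  and \<open>j * (k + 2)\<close> otherwise.\<close>

definition H_family :: "nat \<Rightarrow> nat \<Rightarrow> fps4" where
  "H_family k i = H (k + (if i = 0 then 2 else 1)) (2 * k + (if i \<le> 1 then 4 else 2))
     (3 * k + (if i \<le> 2 then 6 else 3))"

text \<open>Passing from \<open>i\<close> to \<open>Suc i\<close> lowers only parameter number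
  \<open>Suc i\<close>, so each step is one difference equation. Its remainder has the parameters
  raised by \<open>Suc i\<close> times (1, 2, 3), which replaces \<open>k\<close> by
  \<open>k + Suc i\<close>.\<close>

lemma gap_recurrence_H_family: "gap_recurrence 3 block_coeff H_family"
proof
  fix k i n :: nat
  show "H_family k 0 = H_family (Suc k) 3"
    by (simp add: H_family_def eval_nat_numeral)
  show "fps_nth (H_family k 3) n = (if n = 0 then 1 else 0)" if "n \<le> k"
    using that by (simp add: H_family_def H_nth_small)
  assume "i < 3"
  then consider "i = 0" | "i = 1" | "i = 2" by linarith
  thus "H_family k (Suc i) =
      H_family k i + block_coeff (Suc i) * fps_X ^ (Suc i * Suc k) * H_family (k + Suc i) (Suc i)"
  proof cases
    case 1
    thus ?thesis using H_rec1[of "k + 1" "2 * k + 4" "3 * k + 6"]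
      by (simp add: H_family_def block_coeff_def q_var_def eval_nat_numeral)
  next
    case 2
    thus ?thesis using H_rec2[of "k + 1" "2 * k + 2" "3 * k + 6"]
      by (simp add: H_family_def block_coeff_def q_var_def eval_nat_numeral mult_ac)
  next
    case 3
    thus ?thesis using H_rec3[of "k + 1" "2 * k + 2" "3 * k + 3"]
      by (simp add: H_family_def block_coeff_def q_var_def eval_nat_numeral mult_ac)
  qed
qed

section \<open>Gap-frequency partitions\<close>

definition S3_from :: "nat \<Rightarrow> nat \<Rightarrow> nat list set" where
  "S3_from k i = {l \<in> S3. (\<forall>a\<in>set l. k < a) \<and> count_list l (Suc k) \<le> i}"

lemma count_list_replicate: "count_list (replicate n a) b = (if a = b then n else 0)"
  by (induction n) auto

lemma sorted_split_min:
  assumes "sorted l" "\<forall>b\<in>set l. a \<le> (b::'a::linorder)"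
  shows "l = replicate (count_list l a) a @ filter (\<lambda>b. a < b) l"
  using assms
proof (induction l)
  case (Cons b l)
  show ?case
  proof (cases "b = a")
    case True
    have "l = replicate (count_list l a) a @ filter (\<lambda>b. a < b) l"
      using Cons.prems by (intro Cons.IH) simp_all
    with True show ?thesis by (metis (no_types, lifting) append_Cons count_list.simps(2)
      filter.simps(2) less_irrefl replicate_Suc Suc_eq_plus1)
  next
    case False
    with Cons.prems have "\<forall>c\<in>set (b # l). a < c" by fastforce
    hence "filter (\<lambda>b. a < b) (b # l) = b # l" "a \<notin> set (b # l)"
      by (auto simp: filter_id_conv)
    thus ?thesis by (metis append_Nil count_list_0_iff replicate_0)
  qed
qed simp

lemma next_part_replicate_append:
  assumes "i > 0" "\<forall>c\<in>set l. a < c"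
  shows "next_part (replicate i a @ l) u v \<longleftrightarrow>
    next_part l u v \<or> u = a \<and> v \<in> set l \<and> (\<forall>c\<in>set l. v \<le> c)"
proof -
  have set: "set (replicate i a @ l) = insert a (set l)" "a \<notin> set l"
    using assms by auto
  show ?thesis
    using assms(2) set(2) unfolding next_part_def set(1)
    by (cases "u = a") (auto simp: not_less)
qed

text \<open>The block leaves the multiplicities within \<open>l\<close> unchanged, so the only new
  condition is the one between \<open>a\<close> and the least part of \<open>l\<close>.\<close>

lemma gap_frequency_replicate_append:
  assumes i: "i > 0" and l: "\<forall>c\<in>set l. a < c"
  shows "gap_frequency (replicate i a @ l) \<longleftrightarrow>
    gap_frequency l \<and> (\<forall>c\<in>set l. a + i \<le> c) \<and> count_list l (a + i) \<le> i"
proof -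
  have a: "count_list l a = 0"
    using l by (metis count_list_0_iff less_irrefl)
  have np: "u \<noteq> a \<and> v \<noteq> a" if "next_part l u v" for u v
    using that l unfolding next_part_def by blast
  let ?C = "\<lambda>l u v. u + count_list l u \<le> v \<and> (v = u + count_list l u \<longrightarrow> count_list l v \<le> count_list l u)"
  have C: "?C (replicate i a @ l) u v = ?C l u v" if "next_part l u v" for u v
    using np[OF that] by (simp add: count_list_replicate)
  have Ca: "?C (replicate i a @ l) a v \<longleftrightarrow> a + i \<le> v \<and> (v = a + i \<longrightarrow> count_list l v \<le> i)"
    if "v \<in> set l" for v
    using that l by (auto simp: count_list_replicate a)
  have "gap_frequency (replicate i a @ l) \<longleftrightarrow>
      (\<forall>u v. next_part l u v \<longrightarrow> ?C (replicate i a @ l) u v) \<and>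
      (\<forall>v\<in>set l. (\<forall>c\<in>set l. v \<le> c) \<longrightarrow> ?C (replicate i a @ l) a v)"
    unfolding gap_frequency_def next_part_replicate_append[OF assms] by blast
  also have "(\<forall>u v. next_part l u v \<longrightarrow> ?C (replicate i a @ l) u v) \<longleftrightarrow> gap_frequency l"
    unfolding gap_frequency_def using C by blast
  also have "(\<forall>v\<in>set l. (\<forall>c\<in>set l. v \<le> c) \<longrightarrow> ?C (replicate i a @ l) a v) \<longleftrightarrow>
      (\<forall>c\<in>set l. a + i \<le> c) \<and> count_list l (a + i) \<le> i"
  proof (cases "l = []")
    case False
    define m where "m = Min (set l)"
    have m: "m \<in> set l" "\<forall>c\<in>set l. m \<le> c"
      using False by (auto simp: m_def)
    have "(\<forall>v\<in>set l. (\<forall>c\<in>set l. v \<le> c) \<longrightarrow> ?C (replicate i a @ l) a v) \<longleftrightarrow>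
        ?C (replicate i a @ l) a m"
      using m by (metis le_antisym)
    also have "\<dots> \<longleftrightarrow> a + i \<le> m \<and> (m = a + i \<longrightarrow> count_list l m \<le> i)"
      by (rule Ca) (rule m)
    \<comment> \<open>If \<open>a + i < m\<close>, then \<open>a + i\<close> does not occur in
      \<open>l\<close>, so its multiplicity is 0 and the bound holds.\<close>
    also have "\<dots> \<longleftrightarrow> a + i \<le> m \<and> count_list l (a + i) \<le> i"
      using m count_list_0_iff[of l "a + i"] by (metis le_antisym zero_le)
    also have "a + i \<le> m \<longleftrightarrow> (\<forall>c\<in>set l. a + i \<le> c)"
      using m le_trans by blast
    finally show ?thesis .
  qed simp
  finally show ?thesis .
qed

text \<open>Forbidding \<open>Suc k\<close> raises the lower bound on the parts by one, and in
  \<open>S3\<close> every multiplicity is at most 3.\<close>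

lemma S3_from_wrap: "S3_from k 0 = S3_from (Suc k) 3"
proof -
  have "(\<forall>a\<in>set l. k < a) \<and> count_list l (Suc k) \<le> 0 \<longleftrightarrow> (\<forall>a\<in>set l. Suc k < a)" for l
    by (auto simp: count_list_0_iff) (metis Suc_lessI)
  thus ?thesis unfolding S3_from_def S3_def by blast
qed

lemma replicate_append_in_S3_iff:
  assumes i: "0 < i" "i \<le> 3" and l: "\<forall>c\<in>set l. Suc k < c"
  shows "replicate i (Suc k) @ l \<in> S3 \<longleftrightarrow> l \<in> S3_from (k + i) i"
proof -
  have c0: "count_list l (Suc k) = 0"
    using l by (metis count_list_0_iff less_irrefl)
  have "count_list (replicate i (Suc k) @ l) a = (if a = Suc k then i else count_list l a)" for a
    using c0 by (simp add: count_list_replicate)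
  hence count: "(\<forall>a. count_list (replicate i (Suc k) @ l) a \<le> 3) \<longleftrightarrow> (\<forall>a. count_list l a \<le> 3)"
    using i(2) c0 by (metis zero_le)
  have part: "replicate i (Suc k) @ l \<in> partitions \<longleftrightarrow> l \<in> partitions"
    using l i by (auto simp: partitions_def sorted_append less_imp_le)
  show ?thesis
    unfolding S3_def S3_from_def mem_Collect_eq gap_frequency_replicate_append[OF i(1) l]
      count part add_Suc Suc_le_eq
    by blast
qed

text \<open>The multiplicity of \<open>Suc k\<close> is at most \<open>i\<close> or exactly
  \<open>Suc i\<close>; in the second case the block stands at the front of the sorted list and can
  be removed.\<close>

lemma S3_from_step:
  assumes "i < 3"
  shows "S3_from k (Suc i) =
    S3_from k i \<union> (\<lambda>l. replicate (Suc i) (Suc k) @ l) ` S3_from (k + Suc i) (Suc i)"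
proof (intro equalityI subsetI)
  fix l assume l: "l \<in> S3_from k (Suc i)"
  show "l \<in> S3_from k i \<union> (\<lambda>l. replicate (Suc i) (Suc k) @ l) ` S3_from (k + Suc i) (Suc i)"
  proof (cases "count_list l (Suc k) \<le> i")
    case False
    hence "count_list l (Suc k) = Suc i"
      using l by (simp add: S3_from_def)
    moreover have "sorted l" "\<forall>b\<in>set l. Suc k \<le> b"
      using l by (auto simp: S3_from_def S3_def partitions_def)
    ultimately have eq: "l = replicate (Suc i) (Suc k) @ filter (\<lambda>b. Suc k < b) l"
      using sorted_split_min[of l "Suc k"] by simp
    moreover have "l \<in> S3"
      using l by (simp add: S3_from_def)
    ultimately have "filter (\<lambda>b. Suc k < b) l \<in> S3_from (k + Suc i) (Suc i)"
      using replicate_append_in_S3_iff[of "Suc i" "filter (\<lambda>b. Suc k < b) l" k] assms by simp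
    thus ?thesis using eq by blast
  qed (use l in \<open>simp add: S3_from_def\<close>)
next
  fix l assume "l \<in> S3_from k i \<union> (\<lambda>l. replicate (Suc i) (Suc k) @ l) ` S3_from (k + Suc i) (Suc i)"
  thus "l \<in> S3_from k (Suc i)"
  proof
    assume "l \<in> (\<lambda>l. replicate (Suc i) (Suc k) @ l) ` S3_from (k + Suc i) (Suc i)"
    then obtain l' where l': "l = replicate (Suc i) (Suc k) @ l'" "l' \<in> S3_from (k + Suc i) (Suc i)"
      by blast
    have gt: "\<forall>c\<in>set l'. Suc k < c"
      using l'(2) by (auto simp: S3_from_def)
    hence "count_list l' (Suc k) = 0"
      by (metis count_list_0_iff less_irrefl)
    moreover have "l \<in> S3"
      unfolding l'(1) using replicate_append_in_S3_iff[OF _ _ gt, of "Suc i"] l'(2) assms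
      by (simp del: replicate_Suc replicate.simps)
    ultimately show ?thesis
      using gt by (auto simp: S3_from_def l'(1) count_list_replicate)
  qed (simp add: S3_from_def)
qed

lemma S3_from_step_disjoint:
  "S3_from k i \<inter> (\<lambda>l. replicate (Suc i) (Suc k) @ l) ` A = {}"
  by (auto simp: S3_from_def count_list_replicate)

section \<open>Weights and generating functions of the partitions\<close>

lemma num_repeated_replicate_append:
  assumes "i > 0" "a \<notin> set l"
  shows "num_repeated m (replicate i a @ l) = (if m = i then 1 else 0) + num_repeated m l"
proof -
  have "count_list l a = 0"
    using assms by (simp add: count_list_0_iff)
  hence "{b \<in> set (replicate i a @ l). count_list (replicate i a @ l) b = m} =
      (if m = i then {a} else {}) \<union> {b \<in> set l. count_list l b = m}"
    using assms by (auto simp: count_list_replicate)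
  thus ?thesis
    using assms by (simp add: num_repeated_def card_insert_if)
qed

lemma weight_replicate_append:
  assumes "i > 0" "a \<notin> set l"
  shows "weight (replicate i a @ l) = block_coeff i * fps_X ^ (i * a) * weight l"
  by (simp add: weight_def num_repeated_replicate_append[OF assms] block_coeff_def q_var_def
      sum_list_replicate power_add)

text \<open>In the outermost variable q a weight is a monomial, whose coefficient collects the
  powers of x, y and z.\<close>

lemma weight_nth_eq_0:
  assumes "n \<noteq> sum_list l"
  shows "fps_nth (weight l) n = 0"
proof -
  have "weight l = fps_const (fps_const (fps_const fps_X) ^ length l
      * fps_const fps_X ^ num_repeated 2 l * fps_X ^ num_repeated 3 l) * fps_X ^ sum_list l"
    by (simp add: weight_def x_var_def y_var_def z_var_def q_var_def fps_const_power
        flip: fps_const_mult)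
  thus ?thesis using assms by (simp only: fps_mult_left_const_nth fps_X_power_nth) simp
qed

lemma finite_partitions_of: "finite {l \<in> partitions. sum_list l = n}"
proof (rule finite_subset)
  have "length l \<le> sum_list l" if "\<forall>a\<in>set l. 0 < a" for l :: "nat list"
    using that by (induction l) auto
  thus "{l \<in> partitions. sum_list l = n} \<subseteq> {l. set l \<subseteq> {..n} \<and> length l \<le> n}"
    using member_le_sum_list by (auto simp: partitions_def)
  show "finite {l. set l \<subseteq> {..n} \<and> length l \<le> n}"
    by (rule finite_lists_length_le) simp
qed

lemma weight_summable_on:
  assumes "A \<subseteq> partitions"
  shows "weight summable_on A"
proof (rule summable_on_fpsI)
  fix n
  show "finite {l \<in> A. fps_nth (weight l) n \<noteq> 0}"
    by (rule finite_subset[OF _ finite_partitions_of[of n]])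
       (use assms weight_nth_eq_0 in force)
qed

lemma has_sum_weight_S3_from: "(weight has_sum infsum weight (S3_from k i)) (S3_from k i)"
  by (intro has_sum_infsum weight_summable_on) (auto simp: S3_from_def S3_def)

lemma gap_recurrence_weight:
  "gap_recurrence 3 block_coeff (\<lambda>k i. infsum weight (S3_from k i))"
proof
  fix k i n :: nat
  show "infsum weight (S3_from k 0) = infsum weight (S3_from (Suc k) 3)"
    by (simp add: S3_from_wrap)
  show "fps_nth (infsum weight (S3_from k 3)) n = (if n = 0 then 1 else 0)" if "n \<le> k"
  proof -
    have "fps_nth (infsum weight (S3_from k 3)) n = fps_nth (weight []) n"
    proof (rule has_sum_fps_nth_single[OF has_sum_weight_S3_from])
      show "[] \<in> S3_from k 3"
        by (simp add: S3_from_def S3_def partitions_def gap_frequency_def next_part_def)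
    next
      fix l assume l: "l \<in> S3_from k 3" "l \<noteq> []"
      \<comment> \<open>A nonempty partition of this class has size larger than \<open>k\<close>,
        hence larger than \<open>n\<close>, so only the empty one contributes.\<close>
      hence "k < hd l" by (simp add: S3_from_def)
      moreover have "hd l \<le> sum_list l"
        using l(2) by (simp add: member_le_sum_list)
      ultimately show "fps_nth (weight l) n = 0"
        using that by (intro weight_nth_eq_0) simp
    qed
    thus ?thesis by (simp add: weight_def num_repeated_def)
  qed
  assume i: "i < 3"
  let ?r = "\<lambda>l. replicate (Suc i) (Suc k) @ l" and ?B = "S3_from (k + Suc i) (Suc i)"
  let ?c = "block_coeff (Suc i) * fps_X ^ (Suc i * Suc k)"
  \<comment> \<open>Prefixing the block is injective and multiplies every weight by
    \<open>?c\<close>, so the partitions with exactly \<open>Suc i\<close> parts equal to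
    \<open>Suc k\<close> sum to \<open>?c\<close> times the sum over \<open>?B\<close>.\<close>
  have "((\<lambda>l. ?c * weight l) has_sum ?c * infsum weight ?B) ?B"
    by (intro has_sum_cmult_right has_sum_weight_S3_from)
  also have "((\<lambda>l. ?c * weight l) has_sum ?c * infsum weight ?B) ?B \<longleftrightarrow>
      ((weight \<circ> ?r) has_sum ?c * infsum weight ?B) ?B"
  proof (rule has_sum_cong)
    fix l assume "l \<in> ?B"
    hence "Suc k \<notin> set l" by (auto simp: S3_from_def)
    thus "?c * weight l = (weight \<circ> ?r) l"
      unfolding o_def by (subst weight_replicate_append) simp_all
  qed
  also have "\<dots> \<longleftrightarrow> (weight has_sum ?c * infsum weight ?B) (?r ` ?B)"
    by (rule has_sum_reindex[symmetric]) (simp add: inj_on_def)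
  finally have "(weight has_sum ?c * infsum weight ?B) (?r ` ?B)" .
  hence "(weight has_sum (infsum weight (S3_from k i) + ?c * infsum weight ?B))
      (S3_from k (Suc i))"
    unfolding S3_from_step[OF i, of k]
    by (rule has_sum_Un_disjoint[OF has_sum_weight_S3_from _ S3_from_step_disjoint])
  thus "infsum weight (S3_from k (Suc i)) = infsum weight (S3_from k i) + ?c * infsum weight ?B"
    by (rule infsumI)
qed

lemma has_sum_weight_H_family:
  assumes "i \<le> 3"
  shows "(weight has_sum H_family k i) (S3_from k i)"
  using gap_recurrence_unique[OF gap_recurrence_H_family gap_recurrence_weight assms]
    has_sum_weight_S3_from by metis

section \<open>The six classes as members of the family\<close>

lemma S3_eq_S3_from: "S3 = S3_from 0 3"
  by (auto simp: S3_from_def S3_def partitions_def)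

lemma S3_sub_eq_S3_from: "S3_sub i 3 = S3_from 0 i"
  by (auto simp: S3_sub_def S3_from_def S3_def partitions_def)

text \<open>Without parts equal to 1 all parts exceed 1, and 2 is then \<open>Suc k\<close> for
  \<open>k = 1\<close>.\<close>

lemma S3_sub_0_eq_S3_from: "S3_sub 0 j = S3_from 1 j"
proof -
  have "(\<forall>a\<in>set l. 1 < a) \<longleftrightarrow> count_list l 1 = 0" if "l \<in> S3" for l
  proof -
    have "\<forall>a\<in>set l. 0 < a" using that by (simp add: S3_def partitions_def)
    thus ?thesis unfolding count_list_0_iff by (metis Suc_lessI One_nat_def less_irrefl)
  qed
  thus ?thesis by (auto simp: S3_sub_def S3_from_def numeral_2_eq_2)
qed

theorem theorem1p5:
  shows "(weight has_sum H 1 2 3) S3 \<and>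
         (weight has_sum H 1 2 6) (S3_sub 2 3) \<and>
         (weight has_sum H 1 4 6) (S3_sub 1 3) \<and>
         (weight has_sum H 2 4 6) (S3_sub 0 3) \<and>
         (weight has_sum H 2 4 9) (S3_sub 0 2) \<and>
         (weight has_sum H 3 6 9) (S3_sub 0 0)"
  \<comment> \<open>The pairs \<open>(k, i)\<close> of the six classes are (0, 3), (0, 2), (0, 1),
    (0, 0), (1, 2) and (1, 0), in the order of the claim.\<close>
  unfolding S3_eq_S3_from S3_sub_eq_S3_from S3_sub_0_eq_S3_from[of 2] S3_sub_0_eq_S3_from[of 0]
  using has_sum_weight_H_family[of 3 0] has_sum_weight_H_family[of 2 0]
    has_sum_weight_H_family[of 1 0] has_sum_weight_H_family[of 0 0]
    has_sum_weight_H_family[of 2 1] has_sum_weight_H_family[of 0 1]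
  by (simp add: H_family_def eval_nat_numeral)

end
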